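(* Let $G$ be a countably infinite, residually finite, amenable group, let $\mathbf{\Gamma}=(\Gamma_n)_{n\in\mathbb{N}}$ be a decreasing sequence of finite index normal subgroups of $G$ with $\bigcap_{n\in\mathbb{N}}\Gamma_n=\{1_G\}$, and let $x\in\{0,1\}^G$ be a regular Toeplitz array which is relative to $\mathbf{\Gamma}$. Then, for every Følner sequence $\mathcal{F}$ in $G$, $$\overline{\mathrm{ac}}_{\mathcal{F}}(\overline{O_G(x)},G)\le\limsup_{n\to\infty}\frac{\log[G:\Gamma_{n+1}]}{-\log(1-D(x,\Gamma_n))}.$$
   Context: $G$ acts on $\{0,1\}^G$ (product topology) by the shift $(gx)(h)=x(hg)$; $O_G(x)=\{gx:g\in G\}$. Compact shift-invariant subsets of $\{0,1\}^G$ are subshifts. For $x\in\{0,1\}^G$, a subgroup $\Gamma\le G$ and $\alpha\in\{0,1\}$ let $\mathrm{Per}(x,\Gamma,\alpha)=\{g\in G: x(g\gamma)=\alpha\ \forall\gamma\in\Gamma\}$ and $\mathrm{Per}(x,\Gamma)=\mathrm{Per}(x,\Gamma,0)\cup\mathrm{Per}(x,\Gamma,1)$. $x$ is a Toeplitz array if every $g\in G$ lies in $\mathrm{Per}(x,\Gamma)$ for some finite index subgroup $\Gamma$. $x$ is relative to $\mathbf{\Gamma}$ if $G=\bigcup_{n}\mathrm{Per}(x,\Gamma_n)$. For a finite index subgroup $\Gamma$, $D(x,\Gamma)=\#(D\cap\mathrm{Per}(x,\Gamma))/\#D$ with $D$ any fundamental domain of $G/\Gamma$ (a set mapped bijectively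 onto $G/\Gamma$ by $g\mapsto g\Gamma$); this is the asymptotic density of $\mathrm{Per}(x,\Gamma)$ in $G$. A Toeplitz array $x$ is regular if $\sup\{D(x,\Gamma):\Gamma\text{ a finite index subgroup of }G\}=1$. When $D(x,\Gamma_n)=1$, the convention $-\log 0=+\infty$ applies and the quotient is $0$. A Følner sequence in $G$ is a sequence $\mathcal{F}=(F_n)_{n\in\mathbb{N}}$ of nonempty finite subsets with $\#(gF_n\triangle F_n)/\#F_n\to0$ for every $g\in G$. Put $D_{\mathcal{F}}(x,y)=\limsup_{n\to\infty}\frac{1}{\#F_n}\#\{g\in F_n:x(g)\ne y(g)\}$. For a subshift $X$, $[X]_{\mathcal{F}}$ is the image of $X$ in the quotient of $\{0,1\}^G$ by the relation $D_{\mathcal{F}}(x,y)=0$, with metric $D_{\mathcal{F}}$. The upper amorphic complexity $\overline{\mathrm{ac}}_{\mathcal{F}}(X,G)$ is the upper box dimension of $([X]_{\mathcal{F}},D_{\mathcal{F}})$, where for a metric space $(Z,d)$ the upper box dimension is $\limsup_{\varepsilon\to0}\log\mathrm{Sep}(Z,d,\varepsilon)/(-\log\varepsilon)$ and $\mathrm{Sep}(Z,d,\varepsilon)$ is the (possibly infinite) maximal cardinality of a subset whose distinct points have distance $\ge\varepsilon$. *)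

theory Defs
  imports "HOL-Algebra.Left_Coset" "HOL-Analysis.Analysis"
begin

section \<open>Groups\<close>

text \<open>Cosets are left cosets \<open>g\<Gamma>\<close> throughout, so that the quotient \<open>G/\<Gamma>\<close> also makes sense when
  \<open>\<Gamma>\<close> is not normal.\<close>

definition finite_index_subgroup :: "('a, 'b) monoid_scheme \<Rightarrow> 'a set \<Rightarrow> bool" where
  "finite_index_subgroup G H \<longleftrightarrow> subgroup H G \<and> finite (lcosets\<^bsub>G\<^esub> H)"

definition subgroup_index :: "('a, 'b) monoid_scheme \<Rightarrow> 'a set \<Rightarrow> nat" where
  "subgroup_index G H = card (lcosets\<^bsub>G\<^esub> H)"

definition fundamental_domain :: "('a, 'b) monoid_scheme \<Rightarrow> 'a set \<Rightarrow> 'a set \<Rightarrow> bool" where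
  "fundamental_domain G H D \<longleftrightarrow>
     D \<subseteq> carrier G \<and> bij_betw (\<lambda>g. g <#\<^bsub>G\<^esub> H) D (lcosets\<^bsub>G\<^esub> H)"

definition residually_finite :: "('a, 'b) monoid_scheme \<Rightarrow> bool" where
  "residually_finite G \<longleftrightarrow>
     (\<forall>g \<in> carrier G - {\<one>\<^bsub>G\<^esub>}. \<exists>N. N \<lhd> G \<and> finite_index_subgroup G N \<and> g \<notin> N)"

text \<open>Amenability of a discrete group: a left-invariant, finitely additive probability measure is
  defined on all subsets.\<close>

definition amenable :: "('a, 'b) monoid_scheme \<Rightarrow> bool" where
  "amenable G \<longleftrightarrow>
     (\<exists>m :: 'a set \<Rightarrow> real.
        m (carrier G) = 1 \<and>
        (\<forall>A. A \<subseteq> carrier G \<longrightarrow> 0 \<le> m A) \<and>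
        (\<forall>A B. A \<subseteq> carrier G \<and> B \<subseteq> carrier G \<and> A \<inter> B = {} \<longrightarrow> m (A \<union> B) = m A + m B) \<and>
        (\<forall>g \<in> carrier G. \<forall>A. A \<subseteq> carrier G \<longrightarrow> m (g <#\<^bsub>G\<^esub> A) = m A))"

definition folner_sequence :: "('a, 'b) monoid_scheme \<Rightarrow> (nat \<Rightarrow> 'a set) \<Rightarrow> bool" where
  "folner_sequence G F \<longleftrightarrow>
     (\<forall>n. F n \<subseteq> carrier G \<and> finite (F n) \<and> F n \<noteq> {}) \<and>
     (\<forall>g \<in> carrier G.
        (\<lambda>n. real (card (sym_diff (g <#\<^bsub>G\<^esub> F n) (F n))) / real (card (F n))) \<longlonglongrightarrow> 0)"

section \<open>The full shift\<close>

text \<open>The alphabet \<open>{0,1}\<close> is \<^typ>\<open>bool\<close>, with \<open>0\<close> as \<^const>\<open>False\<close>. Points of the full shift are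
  functions on the carrier, i.e. they are \<^const>\<open>undefined\<close> outside of it.\<close>

definition full_shift :: "('a, 'b) monoid_scheme \<Rightarrow> ('a \<Rightarrow> bool) topology" where
  "full_shift G = product_topology (\<lambda>_. discrete_topology (UNIV :: bool set)) (carrier G)"

lemma topspace_full_shift: "topspace (full_shift G) = (carrier G \<rightarrow>\<^sub>E UNIV)"
  by (simp add: full_shift_def)

definition shift :: "('a, 'b) monoid_scheme \<Rightarrow> 'a \<Rightarrow> ('a \<Rightarrow> bool) \<Rightarrow> 'a \<Rightarrow> bool" where
  "shift G g x = (\<lambda>h \<in> carrier G. x (h \<otimes>\<^bsub>G\<^esub> g))"

definition shift_orbit :: "('a, 'b) monoid_scheme \<Rightarrow> ('a \<Rightarrow> bool) \<Rightarrow> ('a \<Rightarrow> bool) set" where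
  "shift_orbit G x = (\<lambda>g. shift G g x) ` carrier G"

section \<open>Toeplitz arrays\<close>

definition Per_val :: "('a, 'b) monoid_scheme \<Rightarrow> ('a \<Rightarrow> bool) \<Rightarrow> 'a set \<Rightarrow> bool \<Rightarrow> 'a set" where
  "Per_val G x H \<alpha> = {g \<in> carrier G. \<forall>\<gamma>\<in>H. x (g \<otimes>\<^bsub>G\<^esub> \<gamma>) = \<alpha>}"

definition Per :: "('a, 'b) monoid_scheme \<Rightarrow> ('a \<Rightarrow> bool) \<Rightarrow> 'a set \<Rightarrow> 'a set" where
  "Per G x H = Per_val G x H False \<union> Per_val G x H True"

definition toeplitz_array :: "('a, 'b) monoid_scheme \<Rightarrow> ('a \<Rightarrow> bool) \<Rightarrow> bool" where
  "toeplitz_array G x \<longleftrightarrow>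
     x \<in> topspace (full_shift G) \<and>
     (\<forall>g \<in> carrier G. \<exists>H. finite_index_subgroup G H \<and> g \<in> Per G x H)"

definition toeplitz_relative :: "('a, 'b) monoid_scheme \<Rightarrow> ('a \<Rightarrow> bool) \<Rightarrow> (nat \<Rightarrow> 'a set) \<Rightarrow> bool" where
  "toeplitz_relative G x \<Gamma> \<longleftrightarrow> carrier G = (\<Union>n. Per G x (\<Gamma> n))"

text \<open>The chosen fundamental domain is immaterial, see \<open>per_density_eq\<close> below.\<close>

definition per_density :: "('a, 'b) monoid_scheme \<Rightarrow> ('a \<Rightarrow> bool) \<Rightarrow> 'a set \<Rightarrow> real" where
  "per_density G x H =
     (let D = (SOME D. fundamental_domain G H D)
      in real (card (D \<inter> Per G x H)) / real (card D))"

definition regular_toeplitz :: "('a, 'b) monoid_scheme \<Rightarrow> ('a \<Rightarrow> bool) \<Rightarrow> bool" where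
  "regular_toeplitz G x \<longleftrightarrow>
     toeplitz_array G x \<and> (SUP H \<in> {H. finite_index_subgroup G H}. per_density G x H) = 1"

section \<open>Upper amorphic complexity\<close>

definition folner_dist :: "(nat \<Rightarrow> 'a set) \<Rightarrow> ('a \<Rightarrow> bool) \<Rightarrow> ('a \<Rightarrow> bool) \<Rightarrow> real" where
  "folner_dist F x y =
     real_of_ereal
       (limsup (\<lambda>n. ereal (real (card {g \<in> F n. x g \<noteq> y g}) / real (card (F n)))))"

definition folner_rel ::
  "('a, 'b) monoid_scheme \<Rightarrow> (nat \<Rightarrow> 'a set) \<Rightarrow> (('a \<Rightarrow> bool) \<times> ('a \<Rightarrow> bool)) set" where
  "folner_rel G F =
     {(x, y). x \<in> topspace (full_shift G) \<and> y \<in> topspace (full_shift G) \<and> folner_dist F x y = 0}"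

definition folner_quotient ::
  "('a, 'b) monoid_scheme \<Rightarrow> (nat \<Rightarrow> 'a set) \<Rightarrow> ('a \<Rightarrow> bool) set \<Rightarrow> ('a \<Rightarrow> bool) set set" where
  "folner_quotient G F X = (\<lambda>x. folner_rel G F `` {x}) ` X"

text \<open>The metric induced on equivalence classes, see \<open>folner_class_dist_eq\<close> below.\<close>

definition folner_class_dist ::
  "(nat \<Rightarrow> 'a set) \<Rightarrow> ('a \<Rightarrow> bool) set \<Rightarrow> ('a \<Rightarrow> bool) set \<Rightarrow> real" where
  "folner_class_dist F A B = (THE d. \<exists>x\<in>A. \<exists>y\<in>B. d = folner_dist F x y)"

text \<open>The natural logarithm on \<open>[0,\<infinity>]\<close>, with \<open>log 0 = -\<infinity>\<close> and \<open>log \<infinity> = \<infinity>\<close>.\<close>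

definition xlog :: "ereal \<Rightarrow> ereal" where
  "xlog t = (if t = \<infinity> then \<infinity> else if t = 0 then - \<infinity> else ereal (ln (real_of_ereal t)))"

definition sep_number :: "'z set \<Rightarrow> ('z \<Rightarrow> 'z \<Rightarrow> real) \<Rightarrow> real \<Rightarrow> enat" where
  "sep_number Z d \<epsilon> =
     (SUP S \<in> {S. S \<subseteq> Z \<and> (\<forall>p\<in>S. \<forall>q\<in>S. p \<noteq> q \<longrightarrow> \<epsilon> \<le> d p q)}.
        if finite S then enat (card S) else \<infinity>)"

definition upper_box_dimension :: "'z set \<Rightarrow> ('z \<Rightarrow> 'z \<Rightarrow> real) \<Rightarrow> ereal" where
  "upper_box_dimension Z d =
     Limsup (at_right 0)
       (\<lambda>\<epsilon>. xlog (ereal_of_enat (sep_number Z d \<epsilon>)) / (- xlog (ereal \<epsilon>)))"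

definition upper_amorphic_complexity ::
  "('a, 'b) monoid_scheme \<Rightarrow> (nat \<Rightarrow> 'a set) \<Rightarrow> ('a \<Rightarrow> bool) set \<Rightarrow> ereal" where
  "upper_amorphic_complexity G F X =
     upper_box_dimension (folner_quotient G F X) (folner_class_dist F)"

section \<open>Well-definedness\<close>

lemma Per_coset_invariant:
  assumes "group G" "subgroup H G" "g \<in> Per G x H" "g' \<in> g <#\<^bsub>G\<^esub> H"
  shows "g' \<in> Per G x H"
proof -
  interpret group G by fact
  interpret subgroup H G by fact
  obtain h where h: "h \<in> H" "g' = g \<otimes>\<^bsub>G\<^esub> h"
    using assms(4) by (auto simp: l_coset_def)
  obtain \<alpha> where g: "g \<in> carrier G" and \<alpha>: "\<forall>\<gamma>\<in>H. x (g \<otimes>\<^bsub>G\<^esub> \<gamma>) = \<alpha>"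
    using assms(3) by (auto simp: Per_def Per_val_def)
  have "\<forall>\<gamma>\<in>H. x (g' \<otimes>\<^bsub>G\<^esub> \<gamma>) = \<alpha>"
    using h g \<alpha> by (simp add: m_assoc)
  moreover have "g' \<in> carrier G"
    using h g by simp
  ultimately show ?thesis
    by (cases \<alpha>) (auto simp: Per_def Per_val_def)
qed

lemma fundamental_domain_exists: "\<exists>D. fundamental_domain G H D"
proof -
  have "lcosets\<^bsub>G\<^esub> H = (\<lambda>g. g <#\<^bsub>G\<^esub> H) ` carrier G"
    by (auto simp: LCOSETS_def)
  then have "lcosets\<^bsub>G\<^esub> H \<subseteq> (\<lambda>g. g <#\<^bsub>G\<^esub> H) ` carrier G"
    by simp
  then obtain D where "D \<subseteq> carrier G" "inj_on (\<lambda>g. g <#\<^bsub>G\<^esub> H) D"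
      "lcosets\<^bsub>G\<^esub> H = (\<lambda>g. g <#\<^bsub>G\<^esub> H) ` D"
    unfolding subset_image_inj by blast
  then show ?thesis
    by (auto simp: fundamental_domain_def bij_betw_def)
qed

lemma fundamental_domain_card:
  assumes "fundamental_domain G H D"
  shows "card D = subgroup_index G H"
  using assms by (auto simp: fundamental_domain_def subgroup_index_def dest: bij_betw_same_card)

lemma fundamental_domain_card_Per:
  assumes "group G" "subgroup H G" "fundamental_domain G H D"
  shows "card (D \<inter> Per G x H) = card {C \<in> lcosets\<^bsub>G\<^esub> H. C \<subseteq> Per G x H}"
proof -
  interpret group G by fact
  have D: "D \<subseteq> carrier G" "bij_betw (\<lambda>g. g <#\<^bsub>G\<^esub> H) D (lcosets\<^bsub>G\<^esub> H)"
    using assms(3) by (auto simp: fundamental_domain_def)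
  have "(\<lambda>g. g <#\<^bsub>G\<^esub> H) ` (D \<inter> Per G x H) = {C \<in> lcosets\<^bsub>G\<^esub> H. C \<subseteq> Per G x H}"
  proof (intro equalityI subsetI)
    fix C assume "C \<in> (\<lambda>g. g <#\<^bsub>G\<^esub> H) ` (D \<inter> Per G x H)"
    then show "C \<in> {C \<in> lcosets\<^bsub>G\<^esub> H. C \<subseteq> Per G x H}"
      using D Per_coset_invariant[OF assms(1,2)] by (auto simp: bij_betw_def)
  next
    fix C assume C: "C \<in> {C \<in> lcosets\<^bsub>G\<^esub> H. C \<subseteq> Per G x H}"
    then have "C \<in> (\<lambda>g. g <#\<^bsub>G\<^esub> H) ` D"
      using D(2) by (simp add: bij_betw_def)
    then obtain g where "g \<in> D" "C = g <#\<^bsub>G\<^esub> H"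
      by blast
    then show "C \<in> (\<lambda>g. g <#\<^bsub>G\<^esub> H) ` (D \<inter> Per G x H)"
      using C D(1) lcos_self[OF _ assms(2)] by blast
  qed
  moreover have "inj_on (\<lambda>g. g <#\<^bsub>G\<^esub> H) (D \<inter> Per G x H)"
    using D(2) by (auto simp: bij_betw_def intro: inj_on_subset)
  ultimately show ?thesis
    by (metis card_image)
qed

lemma per_density_eq:
  assumes "group G" "finite_index_subgroup G H" "fundamental_domain G H D"
  shows "per_density G x H = real (card (D \<inter> Per G x H)) / real (card D)"
proof -
  have H: "subgroup H G"
    using assms(2) by (simp add: finite_index_subgroup_def)
  have "fundamental_domain G H (SOME D. fundamental_domain G H D)"
    using fundamental_domain_exists by (rule someI_ex)
  then show ?thesis
    by (simp add: per_density_def Let_def fundamental_domain_card[OF assms(3)]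
        fundamental_domain_card fundamental_domain_card_Per[OF assms(1) H]
        fundamental_domain_card_Per[OF assms(1) H assms(3)])
qed

lemma folner_freq_le_1:
  "real (card {g \<in> F n. x g \<noteq> y g}) / real (card (F n)) \<le> 1"
proof (cases "finite (F n)")
  case True
  then have "card {g \<in> F n. x g \<noteq> y g} \<le> card (F n)"
    by (intro card_mono) auto
  then show ?thesis
    by (simp add: divide_le_eq_1) linarith
qed simp

lemma folner_dist_ereal:
  "ereal (folner_dist F x y) =
     limsup (\<lambda>n. ereal (real (card {g \<in> F n. x g \<noteq> y g}) / real (card (F n))))"
proof -
  let ?f = "\<lambda>n. ereal (real (card {g \<in> F n. x g \<noteq> y g}) / real (card (F n)))"
  have "limsup ?f \<le> 1"
    by (rule Limsup_bounded) (simp only: one_ereal_def ereal_less_eq folner_freq_le_1 eventually_True)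
  moreover have "0 \<le> limsup ?f"
    by (rule le_Limsup) (auto simp flip: zero_ereal_def)
  ultimately show ?thesis
    unfolding folner_dist_def by (cases "limsup ?f") auto
qed

lemma folner_dist_nonneg: "0 \<le> folner_dist F x y"
proof -
  have "0 \<le> limsup (\<lambda>n. ereal (real (card {g \<in> F n. x g \<noteq> y g}) / real (card (F n))))"
    by (rule le_Limsup) (auto simp flip: zero_ereal_def)
  then show ?thesis
    unfolding folner_dist_ereal[symmetric] by simp
qed

lemma folner_dist_refl: "folner_dist F x x = 0"
  by (simp add: folner_dist_def Limsup_const flip: zero_ereal_def)

lemma folner_dist_commute: "folner_dist F x y = folner_dist F y x"
  by (simp add: folner_dist_def eq_commute)

lemma folner_dist_triangle: "folner_dist F x z \<le> folner_dist F x y + folner_dist F y z"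
proof -
  let ?f = "\<lambda>x y n. real (card {g \<in> F n. x g \<noteq> y g}) / real (card (F n))"
  have "?f x z n \<le> ?f x y n + ?f y z n" for n
  proof (cases "finite (F n)")
    case True
    have "card {g \<in> F n. x g \<noteq> z g} \<le> card ({g \<in> F n. x g \<noteq> y g} \<union> {g \<in> F n. y g \<noteq> z g})"
      using True by (intro card_mono) auto
    also have "\<dots> \<le> card {g \<in> F n. x g \<noteq> y g} + card {g \<in> F n. y g \<noteq> z g}"
      by (rule card_Un_le)
    finally show ?thesis
      by (simp add: divide_right_mono flip: add_divide_distrib of_nat_add)
  qed simp
  then have "limsup (\<lambda>n. ereal (?f x z n)) \<le> limsup (\<lambda>n. ereal (?f x y n) + ereal (?f y z n))"
    by (intro Limsup_mono) simp
  also have "\<dots> \<le> limsup (\<lambda>n. ereal (?f x y n)) + limsup (\<lambda>n. ereal (?f y z n))"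
    by (rule ereal_limsup_add_mono)
  finally show ?thesis
    unfolding folner_dist_ereal[symmetric] by simp
qed

lemma equiv_folner_rel: "equiv (topspace (full_shift G)) (folner_rel G F)"
proof (rule equivI)
  show "folner_rel G F \<subseteq> topspace (full_shift G) \<times> topspace (full_shift G)"
    by (auto simp: folner_rel_def)
  show "refl_on (topspace (full_shift G)) (folner_rel G F)"
    by (auto simp: refl_on_def folner_rel_def folner_dist_refl)
  show "sym (folner_rel G F)"
    by (auto simp: sym_def folner_rel_def folner_dist_commute)
  show "trans (folner_rel G F)"
  proof (rule transI)
    fix x y z assume "(x, y) \<in> folner_rel G F" "(y, z) \<in> folner_rel G F"
    then show "(x, z) \<in> folner_rel G F"
      using folner_dist_triangle[of F x z y] folner_dist_nonneg[of F x z]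
      by (simp add: folner_rel_def)
  qed
qed

lemma folner_class_dist_eq:
  assumes "x \<in> topspace (full_shift G)" "y \<in> topspace (full_shift G)"
  shows "folner_class_dist F (folner_rel G F `` {x}) (folner_rel G F `` {y}) = folner_dist F x y"
proof -
  have "folner_dist F x' y' = folner_dist F x y"
    if "folner_dist F x x' = 0" "folner_dist F y y' = 0" for x' y'
    using that folner_dist_triangle[of F x y x'] folner_dist_triangle[of F x' y y']
      folner_dist_triangle[of F x' y' x] folner_dist_triangle[of F x y' y]
      folner_dist_commute[of F x x'] folner_dist_commute[of F y y']
    by linarith
  then have "d = folner_dist F x y"
    if "\<exists>x' \<in> folner_rel G F `` {x}. \<exists>y' \<in> folner_rel G F `` {y}. d = folner_dist F x' y'" for d
    using that by (auto simp: folner_rel_def)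
  moreover have "x \<in> folner_rel G F `` {x}" "y \<in> folner_rel G F `` {y}"
    using assms by (auto simp: folner_rel_def folner_dist_refl)
  ultimately show ?thesis
    unfolding folner_class_dist_def by (intro the_equality) blast+
qed

end

theory Submission
  imports Defs
begin

text \<open>
  Write \<open>s n\<close> for the index of \<open>\<Gamma> n\<close> and \<open>\<delta> n\<close> for \<open>1 - D(x, \<Gamma> n)\<close>, the density of the
  aperiodic part of \<open>x\<close> at level \<open>n\<close>. The bound comes from covering the orbit closure, at each
  level \<open>n\<close>, by \<open>s n\<close> pieces on each of which \<open>D_F\<close> is at most \<open>\<delta> n\<close>.

  The pieces are indexed by the cosets of \<open>\<Gamma> n\<close>. As there are finitely many of them, a point \<open>y\<close>
  of the orbit closure is already a limit of translates \<open>g x\<close> with \<open>g\<close> in one coset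
  \<open>a \<Gamma> n\<close>, and all of these translates agree at every \<open>h\<close> with \<open>h a\<close> in \<open>Per(x, \<Gamma> n)\<close>, so \<open>y\<close>
  agrees with them there (\<open>orbit_closure_agrees_on_translated_Per\<close>). Two points with the same
  coset therefore differ only outside \<open>Per(x, \<Gamma> n) a\<inverse>\<close>. By normality that set is, like
  \<open>Per(x, \<Gamma> n)\<close> itself, a union of left cosets, and the number of cosets is the same. A Folner
  sequence visits all left cosets equally often in the limit (\<open>folner_coset_frequency\<close>), so the
  exceptional set has density \<open>\<delta> n\<close> along every Folner sequence. Hence an \<open>\<epsilon>\<close>-separated
  set with \<open>\<epsilon> > \<delta> n\<close> has at most \<open>s n\<close> points (\<open>sep_number_orbit_closure_le\<close>).

  To reach all small \<open>\<epsilon>\<close> one needs \<open>\<delta> n \<longlonglongrightarrow> 0\<close>. Regularity only provides large densities for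
  some finite index subgroups \<open>H\<close> that need not be related to the sequence \<open>\<Gamma>\<close>. But since \<open>x\<close> is
  relative to \<open>\<Gamma>\<close>, every \<open>Per(x, H)\<close> is contained in \<open>Per(x, \<Gamma> N)\<close> for some \<open>N\<close>
  (\<open>Per_subset_Per_relative\<close>), and densities along a Folner sequence compare the two.

  Finally, suppose that no \<open>\<delta> n\<close> vanishes (otherwise the separation numbers are bounded and the
  dimension is at most \<open>0\<close>). Given a small \<open>\<epsilon>\<close>, let \<open>n + 1\<close> be the first level with \<open>\<delta> (n + 1) < \<epsilon>\<close>. Then
  \<open>Sep(\<epsilon>) \<le> s (n + 1)\<close> while \<open>\<epsilon> \<le> \<delta> n\<close>, which is why the index of \<open>\<Gamma> (n + 1)\<close> meets the
  density at level \<open>n\<close> in the quotient (\<open>upper_box_dimension_le_limsup\<close>).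
\<close>

section \<open>Frequencies of cosets along a Folner sequence\<close>

definition visit_frequency :: "(nat \<Rightarrow> 'a set) \<Rightarrow> 'a set \<Rightarrow> nat \<Rightarrow> real" where
  "visit_frequency F A n = real (card (F n \<inter> A)) / real (card (F n))"

lemma visit_frequency_mono:
  assumes "finite (F n)" "F n \<inter> A \<subseteq> B"
  shows "visit_frequency F A n \<le> visit_frequency F B n"
proof -
  have "card (F n \<inter> A) \<le> card (F n \<inter> B)"
    using assms by (intro card_mono) auto
  then show ?thesis
    by (simp add: visit_frequency_def divide_right_mono)
qed

lemma visit_frequency_Union:
  assumes "finite (F n)" "finite K" "disjoint K"
  shows "visit_frequency F (\<Union>K) n = (\<Sum>C\<in>K. visit_frequency F C n)"
proof -
  have "card (F n \<inter> \<Union>K) = card (\<Union>C\<in>K. F n \<inter> C)"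
    by (simp only: Int_Union)
  also have "\<dots> = (\<Sum>C\<in>K. card (F n \<inter> C))"
    using assms by (intro card_UN_disjoint) (auto simp: disjoint_def)
  finally show ?thesis
    by (simp add: visit_frequency_def sum_divide_distrib)
qed

context group
begin

lemma l_coset_conv_image: "g <#\<^bsub>G\<^esub> A = (\<otimes>) g ` A"
  by (auto simp: l_coset_def)

text \<open>Translation by \<open>g\<close> is a bijection from \<open>F n \<inter> A\<close> onto \<open>g F n \<inter> g A\<close>, and replacing
  \<open>g F n\<close> by \<open>F n\<close> changes the count by at most the symmetric difference.\<close>

lemma folner_translate_frequency:
  assumes F: "folner_sequence G F" and g: "g \<in> carrier G" and A: "A \<subseteq> carrier G"
  shows "(\<lambda>n. visit_frequency F (g <#\<^bsub>G\<^esub> A) n - visit_frequency F A n) \<longlonglongrightarrow> 0"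
proof (rule Lim_null_comparison)
  let ?e = "\<lambda>n. real (card (sym_diff (g <#\<^bsub>G\<^esub> F n) (F n))) / real (card (F n))"
  show "?e \<longlonglongrightarrow> 0"
    using F g by (simp add: folner_sequence_def)
  show "\<forall>\<^sub>F n in sequentially.
      norm (visit_frequency F (g <#\<^bsub>G\<^esub> A) n - visit_frequency F A n) \<le> ?e n"
  proof (rule always_eventually, rule allI)
    fix n
    have Fn: "F n \<subseteq> carrier G" "finite (F n)"
      using F by (auto simp: folner_sequence_def)
    have inj: "inj_on ((\<otimes>) g) (carrier G)"
      using g by (simp add: inj_on_def)
    let ?S = "sym_diff (g <#\<^bsub>G\<^esub> F n) (F n)"
    have fin: "finite (g <#\<^bsub>G\<^esub> F n)"
      using Fn by (simp add: l_coset_conv_image)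
    have "(g <#\<^bsub>G\<^esub> F n) \<inter> (g <#\<^bsub>G\<^esub> A) = (\<otimes>) g ` (F n \<inter> A)"
      unfolding l_coset_conv_image using inj_on_image_Int[OF inj Fn(1) A] by simp
    moreover have "inj_on ((\<otimes>) g) (F n \<inter> A)"
      using inj Fn(1) by (auto intro: inj_on_subset)
    ultimately have eq: "card ((g <#\<^bsub>G\<^esub> F n) \<inter> (g <#\<^bsub>G\<^esub> A)) = card (F n \<inter> A)"
      by (simp add: card_image)
    have "card ((g <#\<^bsub>G\<^esub> F n) \<inter> (g <#\<^bsub>G\<^esub> A)) \<le> card ((F n \<inter> (g <#\<^bsub>G\<^esub> A)) \<union> ?S)"
      using Fn fin by (intro card_mono) auto
    also have "\<dots> \<le> card (F n \<inter> (g <#\<^bsub>G\<^esub> A)) + card ?S"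
      by (rule card_Un_le)
    finally have 1: "card (F n \<inter> A) \<le> card (F n \<inter> (g <#\<^bsub>G\<^esub> A)) + card ?S"
      by (simp only: eq)
    have "card (F n \<inter> (g <#\<^bsub>G\<^esub> A)) \<le> card (((g <#\<^bsub>G\<^esub> F n) \<inter> (g <#\<^bsub>G\<^esub> A)) \<union> ?S)"
      using Fn fin by (intro card_mono) auto
    also have "\<dots> \<le> card ((g <#\<^bsub>G\<^esub> F n) \<inter> (g <#\<^bsub>G\<^esub> A)) + card ?S"
      by (rule card_Un_le)
    finally have 2: "card (F n \<inter> (g <#\<^bsub>G\<^esub> A)) \<le> card (F n \<inter> A) + card ?S"
      by (simp only: eq)
    have "\<bar>real (card (F n \<inter> (g <#\<^bsub>G\<^esub> A))) - real (card (F n \<inter> A))\<bar> \<le> real (card ?S)"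
      using 1 2 by linarith
    then show "norm (visit_frequency F (g <#\<^bsub>G\<^esub> A) n - visit_frequency F A n) \<le> ?e n"
      by (simp add: visit_frequency_def divide_right_mono flip: diff_divide_distrib)
  qed
qed

lemma lcosets_disjoint:
  assumes "subgroup H G"
  shows "disjoint (lcosets H)"
  using lcos_disjoint[OF assms] by (auto simp: disjoint_def pairwise_def disjnt_def)

lemma subgroup_index_pos:
  assumes "finite_index_subgroup G H"
  shows "0 < subgroup_index G H"
  using assms by (auto simp: finite_index_subgroup_def subgroup_index_def card_gt_0_iff LCOSETS_def)

text \<open>The left cosets are translates of \<open>H\<close>, so their frequencies differ asymptotically by \<open>0\<close>;
  as these frequencies add up to \<open>1\<close>, each tends to the reciprocal of their number.\<close>

lemma folner_coset_frequency:
  assumes F: "folner_sequence G F" and H: "finite_index_subgroup G H" and C: "C \<in> lcosets H"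
  shows "visit_frequency F C \<longlonglongrightarrow> 1 / real (subgroup_index G H)"
proof -
  let ?s = "real (subgroup_index G H)"
  have sub: "subgroup H G" and fin: "finite (lcosets H)"
    using H by (auto simp: finite_index_subgroup_def)
  have s: "?s > 0"
    using subgroup_index_pos[OF H] by simp
  have diff: "(\<lambda>n. visit_frequency F B n - visit_frequency F H n) \<longlonglongrightarrow> 0"
    if B: "B \<in> lcosets H" for B
  proof -
    obtain g where "g \<in> carrier G" "B = g <#\<^bsub>G\<^esub> H"
      using B by (auto simp: LCOSETS_def)
    then show ?thesis
      using folner_translate_frequency[OF F] subgroup.subset[OF sub] by simp
  qed
  have total: "(\<Sum>B\<in>lcosets H. visit_frequency F B n) = 1" for n
  proof -
    have Fn: "F n \<subseteq> carrier G" "finite (F n)" "F n \<noteq> {}"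
      using F by (auto simp: folner_sequence_def)
    then have "(\<Sum>B\<in>lcosets H. visit_frequency F B n) = visit_frequency F (carrier G) n"
      using visit_frequency_Union[OF _ fin lcosets_disjoint[OF sub], of F n]
        lcosets_part_G[OF sub] by simp
    also have "\<dots> = 1"
      using Fn by (simp add: visit_frequency_def Int_absorb2)
    finally show ?thesis .
  qed
  have "(\<lambda>n. \<Sum>B\<in>lcosets H. visit_frequency F B n - visit_frequency F H n) \<longlonglongrightarrow>
      (\<Sum>B\<in>lcosets H. 0)"
    by (intro tendsto_sum diff)
  then have "(\<lambda>n. 1 - ?s * visit_frequency F H n) \<longlonglongrightarrow> 0"
    by (simp add: sum_subtractf total subgroup_index_def)
  then have "(\<lambda>n. (1 - (1 - ?s * visit_frequency F H n)) / ?s) \<longlonglongrightarrow> (1 - 0) / ?s"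
    by (intro tendsto_intros) (use s in auto)
  then have "(\<lambda>n. visit_frequency F H n) \<longlonglongrightarrow> 1 / ?s"
    using s by simp
  from tendsto_add[OF diff[OF C] this] show ?thesis
    by simp
qed

lemma folner_Union_coset_frequency:
  assumes F: "folner_sequence G F" and H: "finite_index_subgroup G H" and K: "K \<subseteq> lcosets H"
  shows "visit_frequency F (\<Union>K) \<longlonglongrightarrow> real (card K) / real (subgroup_index G H)"
proof -
  have sub: "subgroup H G" and fin: "finite K"
    using H K by (auto simp: finite_index_subgroup_def intro: finite_subset)
  have "disjoint K"
    using lcosets_disjoint[OF sub] K by (rule pairwise_subset)
  then have "visit_frequency F (\<Union>K) = (\<lambda>n. \<Sum>C\<in>K. visit_frequency F C n)"
    using F fin by (intro ext visit_frequency_Union) (auto simp: folner_sequence_def)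
  moreover have "(\<lambda>n. \<Sum>C\<in>K. visit_frequency F C n) \<longlonglongrightarrow> (\<Sum>C\<in>K. 1 / real (subgroup_index G H))"
    by (intro tendsto_sum folner_coset_frequency[OF F H]) (use K in auto)
  ultimately show ?thesis
    by simp
qed

section \<open>Density of the periodic part\<close>

text \<open>The value \<open>\<alpha>\<close> is kept existential here because \<open>H\<close> is an arbitrary set; for a subgroup it is
  \<open>x g\<close>.\<close>

lemma Per_iff: "g \<in> Per G x H \<longleftrightarrow>
    g \<in> carrier G \<and> (\<exists>\<alpha>. \<forall>\<gamma>\<in>H. x (g \<otimes> \<gamma>) = \<alpha>)"
  by (auto simp: Per_def Per_val_def ex_bool_eq)

lemma Per_subgroup_iff:
  assumes "subgroup H G"
  shows "g \<in> Per G x H \<longleftrightarrow> g \<in> carrier G \<and> (\<forall>\<gamma>\<in>H. x (g \<otimes> \<gamma>) = x g)"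
proof (cases "g \<in> carrier G")
  case True
  then have "x (g \<otimes> \<one>) = x g"
    by simp
  with True show ?thesis
    using subgroup.one_closed[OF assms] unfolding Per_iff by metis
qed (simp add: Per_iff)

lemma Per_antimono: "H \<subseteq> K \<Longrightarrow> Per G x K \<subseteq> Per G x H"
  by (auto simp: Per_def Per_val_def)

lemma Per_eq_Union_lcosets:
  assumes "subgroup H G"
  shows "Per G x H = \<Union> {C \<in> lcosets H. C \<subseteq> Per G x H}"
proof (intro equalityI subsetI)
  fix g assume g: "g \<in> Per G x H"
  then have "g \<in> carrier G"
    by (simp add: Per_iff)
  then have "g <#\<^bsub>G\<^esub> H \<in> lcosets H" "g \<in> g <#\<^bsub>G\<^esub> H"
    using lcos_self[OF _ assms] by (auto simp: LCOSETS_def)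
  moreover have "g <#\<^bsub>G\<^esub> H \<subseteq> Per G x H"
    using Per_coset_invariant[OF is_group assms g] by blast
  ultimately show "g \<in> \<Union> {C \<in> lcosets H. C \<subseteq> Per G x H}"
    by blast
qed auto

lemma per_density_eq_card:
  assumes "finite_index_subgroup G H"
  shows "per_density G x H =
    real (card {C \<in> lcosets H. C \<subseteq> Per G x H}) / real (subgroup_index G H)"
proof -
  obtain D where D: "fundamental_domain G H D"
    using fundamental_domain_exists by blast
  have "subgroup H G"
    using assms by (simp add: finite_index_subgroup_def)
  then show ?thesis
    by (simp add: per_density_eq[OF is_group assms D] fundamental_domain_card[OF D]
        fundamental_domain_card_Per[OF is_group _ D])
qed

lemma folner_Per_frequency:
  assumes "folner_sequence G F" "finite_index_subgroup G H"
  shows "visit_frequency F (Per G x H) \<longlonglongrightarrow> per_density G x H"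
proof -
  have "subgroup H G"
    using assms(2) by (simp add: finite_index_subgroup_def)
  then have "Per G x H = \<Union> {C \<in> lcosets H. C \<subseteq> Per G x H}"
    by (rule Per_eq_Union_lcosets)
  then show ?thesis
    using folner_Union_coset_frequency[OF assms, of "{C \<in> lcosets H. C \<subseteq> Per G x H}"]
    by (simp add: per_density_eq_card[OF assms(2)])
qed

text \<open>The densities of \<open>H\<close> and \<open>K\<close> are counted in different quotients; the frequency along a Folner
  sequence is a common measure for both.\<close>

lemma per_density_mono:
  assumes F: "folner_sequence G F" and "finite_index_subgroup G H" "finite_index_subgroup G K"
    and sub: "Per G x H \<subseteq> Per G x K"
  shows "per_density G x H \<le> per_density G x K"
proof (rule LIMSEQ_le)
  show "visit_frequency F (Per G x H) \<longlonglongrightarrow> per_density G x H"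
    and "visit_frequency F (Per G x K) \<longlonglongrightarrow> per_density G x K"
    using folner_Per_frequency[OF F] assms by auto
  show "\<exists>N. \<forall>n\<ge>N. visit_frequency F (Per G x H) n \<le> visit_frequency F (Per G x K) n"
    using F sub by (auto simp: folner_sequence_def intro!: visit_frequency_mono)
qed

lemma per_density_bounds:
  assumes "finite_index_subgroup G H"
  shows "0 \<le> per_density G x H" "per_density G x H \<le> 1"
proof -
  have "card {C \<in> lcosets H. C \<subseteq> Per G x H} \<le> subgroup_index G H"
    using assms by (auto simp: finite_index_subgroup_def subgroup_index_def intro: card_mono)
  then show "0 \<le> per_density G x H" "per_density G x H \<le> 1"
    using subgroup_index_pos[OF assms] by (auto simp: per_density_eq_card[OF assms])
qed

text \<open>Right translation by \<open>inv a\<close> maps a left coset of \<open>N\<close> to a left coset only because \<open>N\<close> is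
  normal. It permutes the cosets, so the number of those inside the periodic part is preserved.\<close>

lemma folner_translated_Per_frequency:
  assumes F: "folner_sequence G F" and N: "N \<lhd> G" "finite_index_subgroup G N"
    and a: "a \<in> carrier G"
  shows "visit_frequency F {h \<in> carrier G. h \<otimes> a \<in> Per G x N} \<longlonglongrightarrow> per_density G x N"
proof -
  interpret N: normal N G by fact
  have lr: "lcosets N = rcosets N"
    using N.coset_eq by (auto simp: LCOSETS_def RCOSETS_def)
  let ?K = "{C \<in> lcosets N. C \<subseteq> Per G x N}"
  let ?K' = "(\<lambda>C. C #> inv a) ` ?K"
  have carr: "C \<subseteq> carrier G" if "C \<in> ?K" for C
    using that by (auto simp: Per_iff)
  have cancel: "C #> inv a #> a = C" if "C \<in> ?K" for C
    using carr[OF that] a by (simp add: coset_mult_assoc coset_mult_one)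
  have "inj_on (\<lambda>C. C #> inv a) ?K"
    by (rule inj_on_inverseI[where g = "\<lambda>C. C #> a"]) (rule cancel)
  then have card: "card ?K' = card ?K"
    by (rule card_image)
  have "?K' \<subseteq> lcosets N"
  proof
    fix C assume "C \<in> ?K'"
    then obtain g where "g \<in> carrier G" "C = N #> g #> inv a"
      unfolding lr by (auto simp: RCOSETS_def)
    then have "C = N #> (g \<otimes> inv a)" "g \<otimes> inv a \<in> carrier G"
      using a N.subset by (auto simp: coset_mult_assoc)
    then show "C \<in> lcosets N"
      unfolding lr by (auto simp: RCOSETS_def)
  qed
  from folner_Union_coset_frequency[OF F N(2) this]
  have "visit_frequency F (\<Union>?K') \<longlonglongrightarrow> per_density G x N"
    by (simp add: card per_density_eq_card[OF N(2)])
  moreover have "\<Union>?K' = {h \<in> carrier G. h \<otimes> a \<in> Per G x N}"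
  proof -
    have "\<Union>?K' = \<Union>?K #> inv a"
      by (auto simp: r_coset_def)
    also have "\<dots> = Per G x N #> inv a"
      using Per_eq_Union_lcosets[OF N.is_subgroup, of x] by simp
    also have "\<dots> = {h \<in> carrier G. h \<otimes> a \<in> Per G x N}"
    proof (intro equalityI subsetI)
      fix h assume "h \<in> Per G x N #> inv a"
      then obtain p where p: "p \<in> Per G x N" "h = p \<otimes> inv a"
        by (auto simp: r_coset_def)
      then have "p \<in> carrier G"
        by (simp add: Per_iff)
      with p a show "h \<in> {h \<in> carrier G. h \<otimes> a \<in> Per G x N}"
        by (simp add: m_assoc)
    next
      fix h assume h: "h \<in> {h \<in> carrier G. h \<otimes> a \<in> Per G x N}"
      then have "h = (h \<otimes> a) \<otimes> inv a"
        using a by (simp add: m_assoc)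
      with h show "h \<in> Per G x N #> inv a"
        by (auto simp: r_coset_def)
    qed
    finally show ?thesis .
  qed
  ultimately show ?thesis
    by simp
qed

section \<open>Regularity along the given sequence of subgroups\<close>

lemma decseq_finite_sets_stabilize:
  fixes A :: "nat \<Rightarrow> 'c set"
  assumes "decseq A" "finite (A 0)"
  shows "\<exists>N. \<forall>n\<ge>N. A n = A N"
proof -
  have fin: "finite (A n)" for n
    using assms by (auto simp: decseq_def intro: finite_subset)
  obtain N where N: "\<And>n. card (A N) \<le> card (A n)"
    using ex_has_least_nat[of "\<lambda>_. True" 0 "\<lambda>n. card (A n)"] by auto
  have "A n = A N" if "n \<ge> N" for n
    using card_seteq[OF fin[of N], of "A n"] N that assms(1) by (simp add: decseq_def)
  then show ?thesis
    by blast
qed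

text \<open>The set of left \<open>H\<close>-cosets that meet \<open>\<Gamma> n\<close> decreases with \<open>n\<close> within a finite set, so it is
  constant from some \<open>N\<close> on. Let \<open>g\<close> be \<open>H\<close>-periodic and \<open>k \<in> \<Gamma> N\<close>. The point \<open>g k\<close> is
  \<open>\<Gamma> n\<close>-periodic for some \<open>n \<ge> N\<close> that depends on \<open>k\<close>. By the choice of \<open>N\<close> and normality, \<open>k = h \<gamma>'\<close>
  with \<open>h \<in> H\<close> and \<open>\<gamma>' \<in> \<Gamma> n\<close>, whence \<open>x (g k) = x (g h) = x g\<close>: the dependence on \<open>k\<close>
  disappears.\<close>

lemma Per_subset_Per_relative:
  assumes dec: "decseq \<Gamma>" and normal: "\<And>n. \<Gamma> n \<lhd> G"
    and rel: "toeplitz_relative G x \<Gamma>" and H: "finite_index_subgroup G H"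
  obtains N where "Per G x H \<subseteq> Per G x (\<Gamma> N)"
proof -
  let ?A = "\<lambda>n. (\<lambda>\<gamma>. \<gamma> <#\<^bsub>G\<^esub> H) ` \<Gamma> n"
  have sub: "subgroup (\<Gamma> n) G" for n
    using normal by (rule normal_imp_subgroup)
  have Hsub: "subgroup H G" and Hfin: "finite (lcosets H)"
    using H by (auto simp: finite_index_subgroup_def)
  have "decseq ?A"
    using dec by (auto simp: decseq_def)
  moreover have "?A 0 \<subseteq> lcosets H"
    using subgroup.subset[OF sub] by (auto simp: LCOSETS_def)
  then have "finite (?A 0)"
    using Hfin by (rule finite_subset)
  ultimately obtain N where N: "\<And>n. n \<ge> N \<Longrightarrow> ?A n = ?A N"
    using decseq_finite_sets_stabilize[of ?A] by blast
  have "Per G x H \<subseteq> Per G x (\<Gamma> N)"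
  proof
    fix g assume "g \<in> Per G x H"
    then have g: "g \<in> carrier G" and gH: "\<And>h. h \<in> H \<Longrightarrow> x (g \<otimes> h) = x g"
      by (auto simp: Per_subgroup_iff[OF Hsub])
    have "x (g \<otimes> k) = x g" if k: "k \<in> \<Gamma> N" for k
    proof -
      have kG: "k \<in> carrier G"
        using k subgroup.subset[OF sub] by blast
      have "g \<otimes> k \<in> (\<Union>n. Per G x (\<Gamma> n))"
        using m_closed[OF g kG] rel by (simp add: toeplitz_relative_def)
      then obtain m where "g \<otimes> k \<in> Per G x (\<Gamma> m)"
        by blast
      moreover define n where "n = max m N"
      ultimately have gk: "g \<otimes> k \<in> Per G x (\<Gamma> n)"
        using Per_antimono[of "\<Gamma> n" "\<Gamma> m" x] decseqD[OF dec, of m n] by auto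
      \<comment> \<open>This is where \<open>k\<close>, taken from \<open>\<Gamma> N\<close>, is traded for an element of the smaller group.\<close>
      have "k <#\<^bsub>G\<^esub> H \<in> ?A n"
        using N[of n] k by (auto simp: n_def)
      then obtain \<gamma> where \<gamma>: "\<gamma> \<in> \<Gamma> n" "k <#\<^bsub>G\<^esub> H = \<gamma> <#\<^bsub>G\<^esub> H"
        by blast
      have "k \<in> \<gamma> <#\<^bsub>G\<^esub> H"
        using lcos_self[OF kG Hsub] \<gamma>(2) by simp
      then obtain h where h: "h \<in> H" "k = \<gamma> \<otimes> h"
        by (auto simp: l_coset_def)
      have carr: "\<gamma> \<in> carrier G" "h \<in> carrier G"
        using \<gamma>(1) h(1) subgroup.subset[OF sub] subgroup.subset[OF Hsub] by auto
      \<comment> \<open>Normality moves the factor from \<open>\<Gamma> n\<close> to the right of \<open>h\<close>, where periodicity can absorb it.\<close>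
      define \<gamma>' where "\<gamma>' = inv h \<otimes> \<gamma> \<otimes> h"
      have \<gamma>': "\<gamma>' \<in> \<Gamma> n"
        unfolding \<gamma>'_def using normal.inv_op_closed1[OF normal carr(2) \<gamma>(1)] .
      have \<gamma>'G: "\<gamma>' \<in> carrier G"
        using \<gamma>' subgroup.subset[OF sub] by auto
      have k': "k = h \<otimes> \<gamma>'"
        using carr by (simp add: \<gamma>'_def h(2) inv_solve_left m_assoc[symmetric])
      have "x (g \<otimes> k) = x (g \<otimes> k \<otimes> inv \<gamma>')"
        using gk subgroup.m_inv_closed[OF sub \<gamma>'] by (simp add: Per_subgroup_iff[OF sub])
      also have "g \<otimes> k \<otimes> inv \<gamma>' = g \<otimes> h"
        using g carr \<gamma>'G by (simp add: k' m_assoc)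
      also have "x (g \<otimes> h) = x g"
        using h(1) by (rule gH)
      finally show ?thesis .
    qed
    with g show "g \<in> Per G x (\<Gamma> N)"
      by (simp add: Per_subgroup_iff[OF sub])
  qed
  then show ?thesis
    by (rule that)
qed

lemma per_density_tendsto_1:
  assumes F: "folner_sequence G F"
    and dec: "decseq \<Gamma>" and normal: "\<And>n. \<Gamma> n \<lhd> G"
    and fin: "\<And>n. finite_index_subgroup G (\<Gamma> n)"
    and reg: "regular_toeplitz G x" and rel: "toeplitz_relative G x \<Gamma>"
  shows "(\<lambda>n. per_density G x (\<Gamma> n)) \<longlonglongrightarrow> 1"
proof (rule order_tendstoI)
  fix c :: real assume c: "c < 1"
  have "\<exists>H. finite_index_subgroup G H \<and> c < per_density G x H"
  proof (rule ccontr)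
    assume "\<not> ?thesis"
    then have "(SUP H \<in> {H. finite_index_subgroup G H}. per_density G x H) \<le> c"
      using fin by (intro cSUP_least) (auto simp: not_less)
    then show False
      using reg c by (simp add: regular_toeplitz_def)
  qed
  then obtain H where H: "finite_index_subgroup G H" "c < per_density G x H"
    by blast
  obtain N where N: "Per G x H \<subseteq> Per G x (\<Gamma> N)"
    using Per_subset_Per_relative[OF dec normal rel H(1)] .
  have "c < per_density G x (\<Gamma> n)" if "n \<ge> N" for n
  proof -
    have "Per G x H \<subseteq> Per G x (\<Gamma> n)"
      using N Per_antimono[OF decseqD[OF dec that]] by blast
    then show ?thesis
      using H(2) per_density_mono[OF F H(1) fin] by force
  qed
  then show "\<forall>\<^sub>F n in sequentially. c < per_density G x (\<Gamma> n)"
    by (auto simp: eventually_sequentially)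
next
  fix c :: real assume "1 < c"
  then show "\<forall>\<^sub>F n in sequentially. per_density G x (\<Gamma> n) < c"
    using per_density_bounds(2)[OF fin] by (intro always_eventually allI) (rule le_less_trans)
qed

section \<open>Separated sets in the orbit closure\<close>

text \<open>The orbit is a finite union over the cosets \<open>C\<close> of \<open>H\<close>, and closure commutes with finite
  unions. Fixing one coordinate is a closed condition in the product topology, so it passes from
  the translates \<open>g x\<close> with \<open>g \<in> C\<close> to their limits.\<close>

lemma orbit_closure_agrees_on_translated_Per:
  assumes H: "finite_index_subgroup G H"
    and y: "y \<in> full_shift G closure_of shift_orbit G x"
  shows "\<exists>C \<in> lcosets H. \<forall>a\<in>C. \<forall>h\<in>carrier G. h \<otimes> a \<in> Per G x H \<longrightarrow> y h = x (h \<otimes> a)"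
proof -
  have sub: "subgroup H G" and fin: "finite (lcosets H)"
    using H by (auto simp: finite_index_subgroup_def)
  let ?O = "\<lambda>C. (\<lambda>g. shift G g x) ` C"
  have "shift_orbit G x = \<Union> (?O ` (lcosets H))"
    unfolding shift_orbit_def lcosets_part_G[OF sub, symmetric] by blast
  then have "y \<in> (\<Union>C\<in>lcosets H. full_shift G closure_of ?O C)"
    using y fin by (simp add: closure_of_Union)
  then obtain C where C: "C \<in> lcosets H" and yC: "y \<in> full_shift G closure_of ?O C"
    by blast
  have "y h = x (h \<otimes> a)"
    if a: "a \<in> C" and h: "h \<in> carrier G" and Per: "h \<otimes> a \<in> Per G x H" for a h
  proof -
    let ?E = "{z \<in> topspace (full_shift G). z h \<in> {x (h \<otimes> a)}}"
    have "continuous_map (full_shift G) (discrete_topology UNIV) (\<lambda>z. z h)"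
      unfolding full_shift_def using h by (rule continuous_map_product_projection)
    then have closed: "closedin (full_shift G) ?E"
      by (rule closedin_continuous_map_preimage) simp
    obtain b where b: "b \<in> carrier G" "C = b <#\<^bsub>G\<^esub> H"
      using C by (auto simp: LCOSETS_def)
    then have aG: "a \<in> carrier G"
      using a l_coset_carrier[OF _ b(1) sub] by simp
    have "?O C \<subseteq> ?E"
    proof
      fix z assume "z \<in> ?O C"
      then obtain g where g: "g \<in> C" "z = shift G g x"
        by blast
      have "C = a <#\<^bsub>G\<^esub> H"
        using l_repr_independence[OF _ _ sub] a b by simp
      then obtain k where k: "k \<in> H" "g = a \<otimes> k"
        using g(1) by (auto simp: l_coset_def)
      then have "k \<in> carrier G"
        using subgroup.subset[OF sub] by blast
      then have "z h = x (h \<otimes> a \<otimes> k)"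
        using h k(2) aG by (simp add: g(2) shift_def m_assoc)
      also have "\<dots> = x (h \<otimes> a)"
        using Per k(1) by (simp add: Per_subgroup_iff[OF sub])
      finally show "z \<in> ?E"
        by (auto simp: topspace_full_shift g(2) shift_def)
    qed
    then have "y \<in> ?E"
      using closure_of_minimal[OF _ closed] yC by blast
    then show ?thesis
      by simp
  qed
  with C show ?thesis
    by blast
qed

text \<open>Disagreements are confined to the complement of a translated periodic part, whose frequency
  converges; the limit superior in the distance is bounded by that limit.\<close>

lemma folner_dist_le_aperiodic_density:
  assumes F: "folner_sequence G F" and N: "N \<lhd> G" "finite_index_subgroup G N"
    and a: "a \<in> carrier G"
    and agree: "\<And>h. h \<in> carrier G \<Longrightarrow> h \<otimes> a \<in> Per G x N \<Longrightarrow> y h = z h"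
  shows "folner_dist F y z \<le> 1 - per_density G x N"
proof -
  let ?P = "{h \<in> carrier G. h \<otimes> a \<in> Per G x N}"
  have le: "real (card {g \<in> F n. y g \<noteq> z g}) / real (card (F n)) \<le> 1 - visit_frequency F ?P n" for n
  proof -
    have Fn: "F n \<subseteq> carrier G" "finite (F n)" "F n \<noteq> {}"
      using F by (auto simp: folner_sequence_def)
    have "card {g \<in> F n. y g \<noteq> z g} \<le> card (F n - F n \<inter> ?P)"
      using Fn agree by (intro card_mono) auto
    also have "\<dots> = card (F n) - card (F n \<inter> ?P)"
      using Fn(2) by (intro card_Diff_subset) auto
    finally have "real (card {g \<in> F n. y g \<noteq> z g}) \<le> real (card (F n)) - real (card (F n \<inter> ?P))"
      using card_mono[of "F n" "F n \<inter> ?P"] Fn(2) by simp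
    moreover have "real (card (F n)) > 0"
      using Fn by (simp add: card_gt_0_iff)
    ultimately show ?thesis
      by (simp add: visit_frequency_def field_simps)
  qed
  have "(\<lambda>n. ereal (1 - visit_frequency F ?P n)) \<longlonglongrightarrow> ereal (1 - per_density G x N)"
    by (intro tendsto_intros folner_translated_Per_frequency[OF F N a])
  then have "limsup (\<lambda>n. ereal (1 - visit_frequency F ?P n)) = ereal (1 - per_density G x N)"
    by (intro lim_imp_Limsup) auto
  moreover have "ereal (folner_dist F y z) \<le> limsup (\<lambda>n. ereal (1 - visit_frequency F ?P n))"
    unfolding folner_dist_ereal by (intro Limsup_mono always_eventually allI) (simp only: ereal_less_eq le)
  ultimately show ?thesis
    by simp
qed

text \<open>Choosing for each class a representative and a coset that controls it is injective on a
  separated set: representatives with a common coset are closer than \<open>\<epsilon>\<close>.\<close>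

lemma sep_number_orbit_closure_le:
  assumes F: "folner_sequence G F" and N: "N \<lhd> G" "finite_index_subgroup G N"
    and \<epsilon>: "1 - per_density G x N < \<epsilon>"
  shows "sep_number (folner_quotient G F (full_shift G closure_of shift_orbit G x))
      (folner_class_dist F) \<epsilon> \<le> enat (subgroup_index G N)"
  unfolding sep_number_def
proof (rule SUP_least)
  let ?X = "full_shift G closure_of shift_orbit G x"
  let ?cl = "\<lambda>y. folner_rel G F `` {y}"
  fix S assume "S \<in> {S. S \<subseteq> folner_quotient G F ?X \<and>
    (\<forall>p\<in>S. \<forall>q\<in>S. p \<noteq> q \<longrightarrow> \<epsilon> \<le> folner_class_dist F p q)}"
  then have S: "S \<subseteq> ?cl ` ?X"
    and sep: "\<And>p q. p \<in> S \<Longrightarrow> q \<in> S \<Longrightarrow> p \<noteq> q \<Longrightarrow> \<epsilon> \<le> folner_class_dist F p q"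
    by (auto simp: folner_quotient_def)
  have sub: "subgroup N G" and fin: "finite (lcosets N)"
    using N(2) by (auto simp: finite_index_subgroup_def)
  have "\<forall>p\<in>S. \<exists>y. y \<in> ?X \<and> p = ?cl y"
    using S by blast
  then obtain r where r: "\<And>p. p \<in> S \<Longrightarrow> r p \<in> ?X" "\<And>p. p \<in> S \<Longrightarrow> p = ?cl (r p)"
    by metis
  have "\<forall>p\<in>S. \<exists>C. C \<in> lcosets N \<and>
      (\<forall>a\<in>C. \<forall>h\<in>carrier G. h \<otimes> a \<in> Per G x N \<longrightarrow> r p h = x (h \<otimes> a))"
    using orbit_closure_agrees_on_translated_Per[OF N(2) r(1)] by blast
  then obtain c where c: "\<And>p. p \<in> S \<Longrightarrow> c p \<in> lcosets N"
      "\<And>p a h. p \<in> S \<Longrightarrow> a \<in> c p \<Longrightarrow> h \<in> carrier G \<Longrightarrow> h \<otimes> a \<in> Per G x N \<Longrightarrow>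
        r p h = x (h \<otimes> a)"
    by metis
  have "inj_on c S"
  proof (rule inj_onI, rule ccontr)
    fix p q assume pq: "p \<in> S" "q \<in> S" "c p = c q" "p \<noteq> q"
    obtain a where a: "a \<in> carrier G" "a \<in> c p"
      using c(1)[OF pq(1)] lcos_self[OF _ sub] by (auto simp: LCOSETS_def)
    have "folner_dist F (r p) (r q) \<le> 1 - per_density G x N"
      using c(2) pq a by (intro folner_dist_le_aperiodic_density[OF F N a(1)]) simp
    moreover have "r p \<in> topspace (full_shift G)" "r q \<in> topspace (full_shift G)"
      using r(1)[OF pq(1)] r(1)[OF pq(2)] closure_of_subset_topspace[of "full_shift G"] by blast+
    then have "folner_class_dist F p q = folner_dist F (r p) (r q)"
      using folner_class_dist_eq[of "r p" G "r q" F]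
      unfolding r(2)[OF pq(1), symmetric] r(2)[OF pq(2), symmetric] by simp
    ultimately show False
      using sep[OF pq(1,2,4)] \<epsilon> by simp
  qed
  moreover have "c ` S \<subseteq> lcosets N"
    using c(1) by blast
  ultimately have "finite S" "card S \<le> card (lcosets N)"
    using fin by (simp_all add: inj_on_finite card_inj_on_le)
  then show "(if finite S then enat (card S) else \<infinity>) \<le> enat (subgroup_index G N)"
    by (simp add: subgroup_index_def)
qed

end

section \<open>Box dimension from a sequence of scales\<close>

lemma xlog_ereal_of_enat_le:
  assumes "k \<le> enat m" "0 < m"
  shows "xlog (ereal_of_enat k) \<le> ereal (ln (real m))"
proof -
  obtain j where j: "k = enat j" "j \<le> m"
    using assms(1) by (cases k) auto
  then show ?thesis
    using assms(2) by (auto simp: xlog_def ln_mono simp flip: zero_ereal_def)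
qed

lemma xlog_ereal_pos: "0 < t \<Longrightarrow> xlog (ereal t) = ereal (ln t)"
  by (auto simp: xlog_def simp flip: zero_ereal_def)

lemma sep_quotient_le:
  assumes "sep_number Z d \<epsilon> \<le> enat m" "0 < m" "0 < \<epsilon>" "\<epsilon> < 1"
  shows "xlog (ereal_of_enat (sep_number Z d \<epsilon>)) / (- xlog (ereal \<epsilon>))
    \<le> ereal (ln (real m) / (- ln \<epsilon>))"
proof -
  have ln: "- ln \<epsilon> > 0"
    using assms by simp
  have "xlog (ereal_of_enat (sep_number Z d \<epsilon>)) / (- xlog (ereal \<epsilon>))
      \<le> ereal (ln (real m)) / ereal (- ln \<epsilon>)"
    unfolding xlog_ereal_pos[OF assms(3)] uminus_ereal.simps
    using ln xlog_ereal_of_enat_le[OF assms(1,2)] by (intro ereal_divide_right_mono) auto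
  then show ?thesis
    using ln by simp
qed

text \<open>Although \<open>\<delta>\<close> may fail to be monotone, the first \<open>n\<close> with \<open>\<delta> n < \<epsilon>\<close> is preceded by an index
  \<open>k\<close> with \<open>\<epsilon> \<le> \<delta> k\<close>, and it exceeds any given \<open>N\<close> once \<open>\<epsilon>\<close> is below \<open>\<delta> 0, \<dots>, \<delta> N\<close>. That requires
  all \<open>\<delta> n\<close> to be positive. If some \<open>\<delta> N\<close> vanishes, the separation numbers are bounded by \<open>s N\<close>
  for every \<open>\<epsilon>\<close>, so that the dimension is at most \<open>0\<close>, while all terms on the right are
  nonnegative.\<close>

lemma upper_box_dimension_le_limsup:
  fixes s :: "nat \<Rightarrow> nat" and \<delta> :: "nat \<Rightarrow> real"
  assumes sep: "\<And>n \<epsilon>. \<delta> n < \<epsilon> \<Longrightarrow> sep_number Z d \<epsilon> \<le> enat (s n)"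
    and s: "\<And>n. 0 < s n"
    and \<delta>: "\<And>n. 0 \<le> \<delta> n" "\<And>n. \<delta> n \<le> 1" "\<delta> \<longlonglongrightarrow> 0"
  shows "upper_box_dimension Z d
    \<le> limsup (\<lambda>n. ereal (ln (real (s (Suc n)))) / (- xlog (ereal (\<delta> n))))"
proof (cases "\<exists>N. \<delta> N = 0")
  case True
  then obtain N where N: "\<delta> N = 0"
    by blast
  have "\<forall>\<^sub>F \<epsilon> in at_right 0. xlog (ereal_of_enat (sep_number Z d \<epsilon>)) / (- xlog (ereal \<epsilon>))
      \<le> ereal (ln (real (s N)) / (- ln \<epsilon>))"
    using eventually_at_right_real[OF zero_less_one]
  proof eventually_elim
    case (elim \<epsilon>)
    then show ?case
      using sep[of N \<epsilon>] N s by (intro sep_quotient_le) auto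
  qed
  then have "upper_box_dimension Z d \<le> Limsup (at_right 0) (\<lambda>\<epsilon>. ereal (ln (real (s N)) / (- ln \<epsilon>)))"
    unfolding upper_box_dimension_def by (rule Limsup_mono)
  also have "\<dots> = 0"
  proof (rule lim_imp_Limsup)
    have "filterlim (\<lambda>\<epsilon>::real. - ln \<epsilon>) at_top (at_right 0)"
      using ln_at_0 by (simp add: filterlim_uminus_at_top)
    then have "((\<lambda>\<epsilon>. ln (real (s N)) / (- ln \<epsilon>)) \<longlongrightarrow> 0) (at_right 0)"
      by (intro tendsto_divide_0[OF tendsto_const] filterlim_at_top_imp_at_infinity)
    then show "((\<lambda>\<epsilon>. ereal (ln (real (s N)) / (- ln \<epsilon>))) \<longlongrightarrow> 0) (at_right 0)"
      by (simp add: zero_ereal_def)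
  qed simp
  also have "0 \<le> limsup (\<lambda>n. ereal (ln (real (s (Suc n)))) / (- xlog (ereal (\<delta> n))))"
  proof (rule le_Limsup)
    have "0 \<le> ereal (ln (real (s (Suc n)))) / (- xlog (ereal (\<delta> n)))" for n
    proof -
      have "0 \<le> ln (real (s (Suc n)))"
        using s[of "Suc n"] by simp
      moreover have "0 \<le> - xlog (ereal (\<delta> n))"
        using \<delta>(1,2)[of n] by (cases "\<delta> n = 0") (auto simp: xlog_def simp flip: zero_ereal_def)
      ultimately show ?thesis
        by (intro zero_le_divide_ereal) auto
    qed
    then show "\<forall>\<^sub>F n in sequentially. 0 \<le> ereal (ln (real (s (Suc n)))) / (- xlog (ereal (\<delta> n)))"
      by (intro always_eventually allI)
  qed simp
  finally show ?thesis .
next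
  case False
  then have pos: "\<delta> n > 0" for n
    using \<delta>(1)[of n] by (metis less_eq_real_def)
  let ?q = "\<lambda>n. ereal (ln (real (s (Suc n)))) / (- xlog (ereal (\<delta> n)))"
  show ?thesis
  proof (rule dense_ge)
    fix C assume "limsup ?q < C"
    then have "\<forall>\<^sub>F n in sequentially. ?q n < C"
      by (rule Limsup_lessD)
    moreover have "\<forall>\<^sub>F n in sequentially. \<delta> n < 1"
      using \<delta>(3) by (rule order_tendstoD) simp
    ultimately have "\<forall>\<^sub>F n in sequentially. ?q n < C \<and> \<delta> n < 1"
      by (rule eventually_conj)
    then obtain N where N: "\<And>n. n \<ge> N \<Longrightarrow> ?q n < C" "\<And>n. n \<ge> N \<Longrightarrow> \<delta> n < 1"
      unfolding eventually_sequentially by blast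
    have "\<forall>\<^sub>F \<epsilon> in at_right 0. \<forall>m\<in>{..N}. \<epsilon> < \<delta> m"
      by (intro eventually_ball_finite ballI finite_atMost)
        (use pos in \<open>auto simp: eventually_at_right_field\<close>)
    then have "\<forall>\<^sub>F \<epsilon> in at_right 0.
        xlog (ereal_of_enat (sep_number Z d \<epsilon>)) / (- xlog (ereal \<epsilon>)) \<le> C"
      using eventually_at_right_real[OF zero_less_one]
    proof eventually_elim
      case (elim \<epsilon>)
      then have \<epsilon>: "0 < \<epsilon>" "\<epsilon> < 1"
        by auto
      have "\<forall>\<^sub>F n in sequentially. \<delta> n < \<epsilon>"
        using \<delta>(3) \<epsilon>(1) by (rule order_tendstoD)
      then have ex: "\<exists>n. \<delta> n < \<epsilon>"
        by (auto simp: eventually_sequentially)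
      define n where "n = (LEAST n. \<delta> n < \<epsilon>)"
      have n: "\<delta> n < \<epsilon>"
        unfolding n_def using ex by (rule LeastI_ex)
      have "n > N"
        using elim(1) n by (meson atMost_iff not_less order_less_asym)
      then obtain k where k: "n = Suc k" "k \<ge> N"
        by (cases n) auto
      have "\<not> \<delta> k < \<epsilon>"
        using not_less_Least[of k "\<lambda>n. \<delta> n < \<epsilon>"] k(1) by (simp add: n_def)
      then have \<delta>k: "- ln (\<delta> k) \<le> - ln \<epsilon>" "0 < - ln (\<delta> k)"
        using \<epsilon> pos[of k] N(2)[OF k(2)] by (auto simp: ln_mono)
      have "xlog (ereal_of_enat (sep_number Z d \<epsilon>)) / (- xlog (ereal \<epsilon>))
          \<le> ereal (ln (real (s n)) / (- ln \<epsilon>))"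
        using sep[OF n] s \<epsilon> by (rule sep_quotient_le)
      also have "\<dots> \<le> ereal (ln (real (s n)) / (- ln (\<delta> k)))"
        unfolding ereal_less_eq
        using s[of n] \<delta>k by (intro divide_left_mono mult_pos_pos) auto
      also have "\<dots> = ?q k"
        using \<delta>k(2) by (simp add: xlog_ereal_pos[OF pos] k(1))
      also have "\<dots> \<le> C"
        using N(1)[OF k(2)] by simp
      finally show ?case .
    qed
    then show "upper_box_dimension Z d \<le> C"
      unfolding upper_box_dimension_def by (intro Limsup_bounded) 
  qed
qed

section \<open>The bound on amorphic complexity\<close>

theorem theorem1p3:
  fixes G :: "('a, 'b) monoid_scheme" (structure)
    and \<Gamma> :: "nat \<Rightarrow> 'a set"
    and x :: "'a \<Rightarrow> bool"
    and F :: "nat \<Rightarrow> 'a set"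
  assumes "group G"
    and "countable (carrier G)" and "infinite (carrier G)"
    and "residually_finite G"
    and "amenable G"
    and "decseq \<Gamma>"
    and "\<And>n. \<Gamma> n \<lhd> G"
    and "\<And>n. finite_index_subgroup G (\<Gamma> n)"
    and "(\<Inter>n. \<Gamma> n) = {\<one>}"
    and "regular_toeplitz G x"
    and "toeplitz_relative G x \<Gamma>"
    and "folner_sequence G F"
  shows "upper_amorphic_complexity G F (full_shift G closure_of shift_orbit G x)
    \<le> limsup (\<lambda>n. ereal (ln (real (subgroup_index G (\<Gamma> (Suc n)))))
                   / (- xlog (ereal (1 - per_density G x (\<Gamma> n)))))"
proof -
  interpret group G by fact
  note fin = \<open>\<And>n. finite_index_subgroup G (\<Gamma> n)\<close>
  have "(\<lambda>n. per_density G x (\<Gamma> n)) \<longlonglongrightarrow> 1"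
    using assms by (intro per_density_tendsto_1) auto
  then have "(\<lambda>n. 1 - per_density G x (\<Gamma> n)) \<longlonglongrightarrow> 1 - 1"
    by (intro tendsto_intros)
  then show ?thesis
    unfolding upper_amorphic_complexity_def
    using per_density_bounds[OF fin] subgroup_index_pos[OF fin]
      sep_number_orbit_closure_le[OF \<open>folner_sequence G F\<close> \<open>\<And>n. \<Gamma> n \<lhd> G\<close> fin]
    by (intro upper_box_dimension_le_limsup) auto
qed

end
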